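(* Let $\mathcal{A}$ be an HDA satisfying conditions HM1, HM2 and HM3 with respect to a deterministic $\ltimes$-transition system $\mathcal{T}$ such that $\ltimes_\mathcal{T}$ is asymmetric. Let $v\in(P_\mathcal{A})_0$ and let $\alpha_1,\dots,\alpha_n\in\Sigma_\mathcal{A}$ with $n\ge2$. Then there exists at most one $x\in(P_\mathcal{A})_n$ such that $d^0_1\cdots d^0_nx=v$ and $\{\lambda_\mathcal{A}(d^0_1\cdots d^0_{i-1}d^0_{i+1}\cdots d^0_nx)\mid i\in\{1,\dots,n\}\}=\{\alpha_1,\dots,\alpha_n\}$.
   Context: A precubical set $P$ is a family of sets $(P_n)_{n\ge0}$ with face maps $d^k_i:P_n\to P_{n-1}$ ($n>0$, $k\in\{0,1\}$, $1\le i\le n$) satisfying $d^k_id^l_j=d^l_{j-1}d^k_i$ for $i<j$; composites of face maps are applied right to left. An HDA is $\mathcal{A}=(P_\mathcal{A},I_\mathcal{A},F_\mathcal{A},\Sigma_\mathcal{A},\lambda_\mathcal{A})$ with $P_\mathcal{A}$ a precubical set, $I_\mathcal{A}$ a vertex, $F_\mathcal{A}$ a set of vertices, $\lambda_\mathcal{A}:(P_\mathcal{A})_1\to\Sigma_\mathcal{A}$ with $\lambda_\mathcal{A}(d^0_iz)=\lambda_\mathcal{A}(d^1_iz)$ for 2-cubes $z$, $i=1,2$; $\mathcal{A}_{\le1}$ keeps cubes of degree $\le1$. A transition system is an HDA without cubes of degree $\ge2$ in which two edges with equal label, equal $d^0_1$ and equal $d^1_1$ coincide. A $\ltimes$-transition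 system $\mathcal{T}$ is a transition system $U(\mathcal{T})$ with a binary relation $\ltimes_\mathcal{T}$ on its label set; it is deterministic if any two edges with the same label and the same $d^0_1$ are equal; $\ltimes_\mathcal{T}$ asymmetric means $\alpha\ltimes_\mathcal{T}\beta$ implies not $\beta\ltimes_\mathcal{T}\alpha$. Conditions: (HM1) $\mathcal{A}_{\le1}=U(\mathcal{T})$; (HM2) for all $z\in(P_\mathcal{A})_2$, $\lambda_\mathcal{A}(d^0_2z)\ltimes_\mathcal{T}\lambda_\mathcal{A}(d^0_1z)$; (HM3) for all $m\ge2$ and $y,z\in(P_\mathcal{A})_m$, if $d^k_ry=d^k_rz$ for all $r\in\{1,\dots,m\}$, $k\in\{0,1\}$, then $y=z$. *)

theory Defs
  imports Main
begin

text \<open>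
  The cubes of all degrees live in one type \<open>'c\<close>; the sets \<open>cubes P n\<close> need not be disjoint, so
  the face maps carry the degree of their argument: \<open>face P n k i\<close> is
  \<open>d\<^sup>k\<^sub>i : P\<^sub>n \<rightarrow> P\<^sub>n\<^sub>-\<^sub>1\<close>, meaningful for \<open>n > 0\<close>, \<open>k \<in> {0, 1}\<close>, \<open>i \<in> {1..n}\<close>
  and arguments in \<open>cubes P n\<close> only.
\<close>

record 'c precubical =
  cubes :: "nat \<Rightarrow> 'c set"
  face :: "nat \<Rightarrow> nat \<Rightarrow> nat \<Rightarrow> 'c \<Rightarrow> 'c"

definition precubical_set :: "'c precubical \<Rightarrow> bool" where
  "precubical_set P \<longleftrightarrow>
     (\<forall>n>0. \<forall>k\<in>{0, 1}. \<forall>i\<in>{1..n}. \<forall>x\<in>cubes P n. face P n k i x \<in> cubes P (n - 1)) \<and>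
     (\<forall>n. \<forall>k\<in>{0, 1}. \<forall>l\<in>{0, 1}. \<forall>i j. 1 \<le> i \<and> i < j \<and> j \<le> n \<longrightarrow>
        (\<forall>x\<in>cubes P n.
           face P (n - 1) k i (face P n l j x) = face P (n - 1) l (j - 1) (face P n k i x)))"

text \<open>
  \<open>faces P k [i\<^sub>1, \<dots>, i\<^sub>r] n x\<close> is \<open>d\<^sup>k\<^sub>i\<^sub>1 \<cdots> d\<^sup>k\<^sub>i\<^sub>r x\<close> for \<open>x\<close> of degree \<open>n\<close>; the last index is
  applied first.
\<close>

fun faces :: "'c precubical \<Rightarrow> nat \<Rightarrow> nat list \<Rightarrow> nat \<Rightarrow> 'c \<Rightarrow> 'c" where
  "faces P k [] n x = x"
| "faces P k (i # js) n x = face P (n - length js) k i (faces P k js n x)"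

record ('c, 'l) hda =
  pcs :: "'c precubical"
  initial :: 'c
  finals :: "'c set"
  alphabet :: "'l set"
  lab :: "'c \<Rightarrow> 'l"

abbreviation hcubes :: "('c, 'l) hda \<Rightarrow> nat \<Rightarrow> 'c set" where
  "hcubes A \<equiv> cubes (pcs A)"

abbreviation hface :: "('c, 'l) hda \<Rightarrow> nat \<Rightarrow> nat \<Rightarrow> nat \<Rightarrow> 'c \<Rightarrow> 'c" where
  "hface A \<equiv> face (pcs A)"

definition is_hda :: "('c, 'l) hda \<Rightarrow> bool" where
  "is_hda A \<longleftrightarrow>
     precubical_set (pcs A) \<and>
     initial A \<in> hcubes A 0 \<and>
     finals A \<subseteq> hcubes A 0 \<and>
     (\<forall>e\<in>hcubes A 1. lab A e \<in> alphabet A) \<and>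
     (\<forall>z\<in>hcubes A 2. \<forall>i\<in>{1, 2}. lab A (hface A 2 0 i z) = lab A (hface A 2 1 i z))"

definition skeleton1 :: "('c, 'l) hda \<Rightarrow> ('c, 'l) hda" where
  "skeleton1 A =
     A\<lparr>pcs := (pcs A)\<lparr>cubes := (\<lambda>n. if n \<le> 1 then hcubes A n else {})\<rparr>\<rparr>"

text \<open>
  Equality of HDAs as mathematical objects: values of the face and labelling functions outside
  their domains are irrelevant.
\<close>

definition same_hda :: "('c, 'l) hda \<Rightarrow> ('c, 'l) hda \<Rightarrow> bool" where
  "same_hda A B \<longleftrightarrow>
     (\<forall>n. hcubes A n = hcubes B n) \<and>
     (\<forall>n>0. \<forall>k\<in>{0, 1}. \<forall>i\<in>{1..n}. \<forall>x\<in>hcubes A n. hface A n k i x = hface B n k i x) \<and>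
     initial A = initial B \<and>
     finals A = finals B \<and>
     alphabet A = alphabet B \<and>
     (\<forall>e\<in>hcubes A 1. lab A e = lab B e)"

definition transition_system :: "('c, 'l) hda \<Rightarrow> bool" where
  "transition_system T \<longleftrightarrow>
     is_hda T \<and>
     (\<forall>n\<ge>2. hcubes T n = {}) \<and>
     (\<forall>x\<in>hcubes T 1. \<forall>y\<in>hcubes T 1.
        lab T x = lab T y \<and> hface T 1 0 1 x = hface T 1 0 1 y \<and>
        hface T 1 1 1 x = hface T 1 1 1 y \<longrightarrow> x = y)"

record ('c, 'l) ltimes_ts =
  underlying :: "('c, 'l) hda"
  ltimes :: "'l rel"

definition ltimes_transition_system :: "('c, 'l) ltimes_ts \<Rightarrow> bool" where
  "ltimes_transition_system T \<longleftrightarrow>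
     transition_system (underlying T) \<and>
     ltimes T \<subseteq> alphabet (underlying T) \<times> alphabet (underlying T)"

definition deterministic :: "('c, 'l) ltimes_ts \<Rightarrow> bool" where
  "deterministic T \<longleftrightarrow>
     (\<forall>x\<in>hcubes (underlying T) 1. \<forall>y\<in>hcubes (underlying T) 1.
        lab (underlying T) x = lab (underlying T) y \<and>
        hface (underlying T) 1 0 1 x = hface (underlying T) 1 0 1 y \<longrightarrow> x = y)"

definition HM1 :: "('c, 'l) hda \<Rightarrow> ('c, 'l) ltimes_ts \<Rightarrow> bool" where
  "HM1 A T \<longleftrightarrow> same_hda (skeleton1 A) (underlying T)"

definition HM2 :: "('c, 'l) hda \<Rightarrow> ('c, 'l) ltimes_ts \<Rightarrow> bool" where
  "HM2 A T \<longleftrightarrow>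
     (\<forall>z\<in>hcubes A 2. (lab A (hface A 2 0 2 z), lab A (hface A 2 0 1 z)) \<in> ltimes T)"

definition HM3 :: "('c, 'l) hda \<Rightarrow> bool" where
  "HM3 A \<longleftrightarrow>
     (\<forall>m\<ge>2. \<forall>y\<in>hcubes A m. \<forall>z\<in>hcubes A m.
        (\<forall>r\<in>{1..m}. \<forall>k\<in>{0, 1}. hface A m k r y = hface A m k r z) \<longrightarrow> y = z)"

end

theory Submission
  imports Defs
begin

text \<open>
  The edges of a cube \<open>x\<close> at its initial vertex carry labels that are increasing for
  \<open>\<ltimes>\<close> in the direction \<open>i\<close>, by HM2 applied to the 2-dimensional initial faces. As
  \<open>\<ltimes>\<close> is asymmetric, the label sequence is determined by its set of values. The initial
  vertex together with the label sequence determines \<open>x\<close>, by induction on the degree: by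
  determinism they determine the edges at the initial vertex, hence the initial vertices of all
  faces of \<open>x\<close>; parallel edges have equal labels, so the label sequences of the faces are
  known as well, and HM3 applies.
\<close>

section \<open>Initial vertices and initial edges of a cube\<close>

definition initial_vertex :: "'c precubical \<Rightarrow> nat \<Rightarrow> 'c \<Rightarrow> 'c" where
  "initial_vertex P n x = faces P 0 [1..<Suc n] n x"

text \<open>Directions are removed from the highest down, so no remaining index is shifted and the
  surviving direction is the \<open>i\<close>-th.\<close>

definition initial_edge :: "'c precubical \<Rightarrow> nat \<Rightarrow> nat \<Rightarrow> 'c \<Rightarrow> 'c" where
  "initial_edge P n i x = faces P 0 ([1..<i] @ [Suc i..<Suc n]) n x"

text \<open>The recursion of \<open>faces\<close> strips the face map applied last; inductions on
  the degree must strip the one applied first.\<close>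

lemma faces_snoc: "faces P k (js @ [j]) (Suc n) x = faces P k js n (face P (Suc n) k j x)"
  by (induction js) auto

lemma initial_vertex_Suc:
  "initial_vertex P (Suc n) x = initial_vertex P n (face P (Suc n) 0 (Suc n) x)"
  using faces_snoc[of P 0 "[1..<Suc n]"] by (simp add: initial_vertex_def)

lemma initial_edge_Suc:
  assumes "i \<le> n"
  shows "initial_edge P (Suc n) i x = initial_edge P n i (face P (Suc n) 0 (Suc n) x)"
  using faces_snoc[of P 0 "[1..<i] @ [Suc i..<Suc n]"] assms by (simp add: initial_edge_def)

text \<open>The top direction has to survive, so the one just below is removed first; the top
  direction then gets the index \<open>n\<close>.\<close>

lemma initial_edge_Suc_last:
  assumes "n > 0"
  shows "initial_edge P (Suc n) (Suc n) x = initial_edge P n n (face P (Suc n) 0 n x)"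
  using faces_snoc[of P 0 "[1..<n]" n n x] assms by (simp add: initial_edge_def)

lemma initial_vertex_0 [simp]: "initial_vertex P 0 x = x"
  by (simp add: initial_vertex_def)

lemma initial_edge_1 [simp]: "initial_edge P (Suc 0) (Suc 0) x = x"
  by (simp add: initial_edge_def)

lemmas initial_simps = initial_vertex_Suc initial_edge_Suc initial_edge_Suc_last

section \<open>Initial vertices and initial edges of faces\<close>

lemma face_in_cubes:
  assumes "precubical_set P" "x \<in> cubes P (Suc n)" "k \<in> {0, 1}" "1 \<le> i" "i \<le> Suc n"
  shows "face P (Suc n) k i x \<in> cubes P n"
  using assms unfolding precubical_set_def by fastforce

lemma face_face:
  assumes "precubical_set P" "x \<in> cubes P (Suc n)" "k \<in> {0, 1}" "l \<in> {0, 1}"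
    and "1 \<le> i" "i < j" "j \<le> Suc n"
  shows "face P n k i (face P (Suc n) l j x) = face P n l (j - 1) (face P (Suc n) k i x)"
  using assms unfolding precubical_set_def by (metis diff_Suc_1)

text \<open>Computing an initial vertex starts with the top face map; a lower d^0_r commutes past
  it, and the induction hypothesis applies to the top face.\<close>

lemma initial_vertex_face0:
  assumes "precubical_set P" "x \<in> cubes P (Suc n)" "1 \<le> r" "r \<le> Suc n"
  shows "initial_vertex P n (face P (Suc n) 0 r x) = initial_vertex P (Suc n) x"
  using assms
proof (induction n arbitrary: x r)
  case (Suc n)
  show ?case
  proof (cases "r = Suc (Suc n)")
    case False
    have "initial_vertex P (Suc n) (face P (Suc (Suc n)) 0 r x)
        = initial_vertex P n (face P (Suc n) 0 r (face P (Suc (Suc n)) 0 (Suc (Suc n)) x))"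
      using Suc.prems False
      by (simp add: initial_vertex_Suc face_face[of _ _ _ 0 0 r "Suc (Suc n)"])
    also have "\<dots> = initial_vertex P (Suc n) (face P (Suc (Suc n)) 0 (Suc (Suc n)) x)"
      using Suc.prems False by (intro Suc.IH) (auto intro: face_in_cubes)
    finally show ?thesis
      by (simp only: initial_vertex_Suc)
  qed (simp only: initial_vertex_Suc)
qed (auto simp: initial_vertex_Suc le_Suc_eq)

text \<open>Removing direction \<open>r\<close> lowers the index of every direction above it by
  one.\<close>

lemma initial_edge_face0:
  assumes "precubical_set P" "x \<in> cubes P (Suc n)" "1 \<le> r" "r \<le> Suc n" "1 \<le> i" "i \<le> n"
  shows "initial_edge P n i (face P (Suc n) 0 r x)
       = initial_edge P (Suc n) (if i < r then i else Suc i) x"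
  using assms
proof (induction n arbitrary: x r i)
  case (Suc n)
  note P = \<open>precubical_set P\<close> and x = \<open>x \<in> cubes P (Suc (Suc n))\<close>
  let ?F = "\<lambda>r. face P (Suc (Suc n)) 0 r x"
  have F: "?F j \<in> cubes P (Suc n)" if "1 \<le> j" "j \<le> Suc (Suc n)" for j
    using P x that by (auto intro: face_in_cubes)
  have comm: "face P (Suc n) 0 i (?F j) = face P (Suc n) 0 (j - 1) (?F i)"
    if "1 \<le> i" "i < j" "j \<le> Suc (Suc n)" for i j
    using P x that by (intro face_face) auto
  \<comment> \<open>The cases differ in which direction of \<open>x\<close> is removed first. In the
    first two it is the top one; in the last two the top one survives, and the one below it goes
    first.\<close>
  consider "r = Suc (Suc n)" | "r \<le> Suc n" "i \<le> n" | "r = Suc n" "i = Suc n" | "r \<le> n" "i = Suc n"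
    using Suc.prems by linarith
  then show ?case
  proof cases
    case 1
    then show ?thesis using Suc.prems by (simp add: initial_edge_Suc)
  next
    case 2
    have "initial_edge P (Suc n) i (?F r)
        = initial_edge P n i (face P (Suc n) 0 r (?F (Suc (Suc n))))"
      using 2 Suc.prems comm[of r "Suc (Suc n)"] by (simp add: initial_edge_Suc)
    also have "\<dots> = initial_edge P (Suc n) (if i < r then i else Suc i) (?F (Suc (Suc n)))"
      using 2 Suc.prems F by (intro Suc.IH) auto
    also have "\<dots> = initial_edge P (Suc (Suc n)) (if i < r then i else Suc i) x"
      using 2 by (simp add: initial_edge_Suc)
    finally show ?thesis .
  next
    case 3
    then show ?thesis by (simp add: initial_edge_Suc_last)
  next
    case 4
    then have "n > 0" using Suc.prems by simp
    have "initial_edge P (Suc n) (Suc n) (?F r)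
        = initial_edge P n n (face P (Suc n) 0 r (?F (Suc n)))"
      using 4 Suc.prems comm[of r "Suc n"] \<open>n > 0\<close>
      by (simp add: initial_edge_Suc_last)
    also have "\<dots> = initial_edge P (Suc n) (if n < r then n else Suc n) (?F (Suc n))"
      using 4 Suc.prems F \<open>n > 0\<close> by (intro Suc.IH) auto
    also have "\<dots> = initial_edge P (Suc (Suc n)) (Suc (Suc n)) x"
      using 4 by (simp add: initial_edge_Suc_last)
    finally show ?thesis using 4 by simp
  qed
qed simp

lemma initial_edge_in_cubes:
  assumes "precubical_set P" "x \<in> cubes P n" "1 \<le> i" "i \<le> n"
  shows "initial_edge P n i x \<in> cubes P 1"
  using assms
proof (induction n arbitrary: x i)
  case (Suc n)
  show ?case
  proof (cases "n = 0")
    case True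
    then have "i = Suc 0" using Suc.prems by simp
    then show ?thesis using True Suc.prems by simp
  next
    case False
    \<comment> \<open>\<open>r\<close> is the first direction removed: the top one, unless that one
      survives. The surviving direction then has index \<open>min i n\<close>.\<close>
    define r where "r = (if i \<le> n then Suc n else n)"
    have "initial_edge P (Suc n) i x = initial_edge P n (min i n) (face P (Suc n) 0 r x)"
      using False Suc.prems
      by (cases "i = Suc n") (auto simp: r_def initial_simps min_def)
    moreover have "initial_edge P n (min i n) (face P (Suc n) 0 r x) \<in> cubes P 1"
      using Suc.prems False by (intro Suc.IH face_in_cubes) (auto simp: r_def)
    ultimately show ?thesis
      by (simp only:)
  qed
qed simp

lemma initial_vertex_initial_edge:
  assumes "precubical_set P" "x \<in> cubes P n" "1 \<le> i" "i \<le> n"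
  shows "face P 1 0 1 (initial_edge P n i x) = initial_vertex P n x"
  using assms
proof (induction n arbitrary: x i)
  case (Suc n)
  show ?case
  proof (cases "n = 0")
    case True
    then have "i = Suc 0" using Suc.prems by simp
    then show ?thesis using True by (simp add: initial_vertex_Suc)
  next
    case False
    define r where "r = (if i \<le> n then Suc n else n)"
    have "initial_edge P (Suc n) i x = initial_edge P n (min i n) (face P (Suc n) 0 r x)"
      using False Suc.prems
      by (cases "i = Suc n") (auto simp: r_def initial_simps min_def)
    moreover have "face P 1 0 1 (initial_edge P n (min i n) (face P (Suc n) 0 r x))
        = initial_vertex P n (face P (Suc n) 0 r x)"
      using Suc.prems False by (intro Suc.IH face_in_cubes) (auto simp: r_def)
    moreover have "\<dots> = initial_vertex P (Suc n) x"
      using Suc.prems False by (intro initial_vertex_face0) (auto simp: r_def)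
    ultimately show ?thesis by metis
  qed
qed simp

text \<open>The \<open>r\<close>-th initial edge runs from the initial vertex of \<open>x\<close> to
  that of its upper face in direction \<open>r\<close>. The proof removes another direction first,
  commuting d^0_s with d^1_r.\<close>

lemma initial_vertex_face1:
  assumes "precubical_set P" "x \<in> cubes P (Suc n)" "1 \<le> r" "r \<le> Suc n"
  shows "initial_vertex P n (face P (Suc n) 1 r x) = face P 1 1 1 (initial_edge P (Suc n) r x)"
  using assms
proof (induction n arbitrary: x r)
  case 0
  then have "r = Suc 0" by simp
  then show ?case by simp
next
  case (Suc n)
  \<comment> \<open>\<open>s\<close> is the highest direction other than \<open>r\<close>; without
    it, \<open>r\<close> becomes \<open>min r (Suc n)\<close>.\<close>
  define s where "s = (if r = Suc (Suc n) then Suc n else Suc (Suc n))"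
  let ?y = "face P (Suc (Suc n)) 0 s x"
  have "face P (Suc n) 0 (Suc n) (face P (Suc (Suc n)) 1 r x) = face P (Suc n) 1 (min r (Suc n)) ?y"
  proof (cases "r = Suc (Suc n)")
    case True
    then show ?thesis using Suc.prems face_face[of P x "Suc n" 0 1 "Suc n" r] by (simp add: s_def)
  next
    case False
    then show ?thesis using Suc.prems face_face[of P x "Suc n" 1 0 r "Suc (Suc n)"]
      by (simp add: s_def)
  qed
  then have "initial_vertex P (Suc n) (face P (Suc (Suc n)) 1 r x)
      = initial_vertex P n (face P (Suc n) 1 (min r (Suc n)) ?y)"
    by (simp only: initial_vertex_Suc)
  also have "\<dots> = face P 1 1 1 (initial_edge P (Suc n) (min r (Suc n)) ?y)"
    using Suc.prems by (intro Suc.IH face_in_cubes) (auto simp: s_def)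
  also have "initial_edge P (Suc n) (min r (Suc n)) ?y = initial_edge P (Suc (Suc n)) r x"
    using Suc.prems
    by (cases "r = Suc (Suc n)") (auto simp: s_def initial_simps min_def)
  finally show ?case .
qed

section \<open>Labels of initial edges and their order\<close>

text \<open>The two edges are opposite sides of a square inside \<open>x\<close>. Removing the other
  directions leads to that square, where the HDA axiom equates the labels.\<close>

lemma lab_initial_edge_face1:
  assumes "is_hda A" "x \<in> hcubes A (Suc n)" "1 \<le> r" "r \<le> Suc n" "1 \<le> i" "i \<le> n"
  shows "lab A (initial_edge (pcs A) n i (hface A (Suc n) 1 r x))
       = lab A (initial_edge (pcs A) n i (hface A (Suc n) 0 r x))"
  using assms
proof (induction n arbitrary: x r i)
  case (Suc n)
  have P: "precubical_set (pcs A)" using Suc.prems by (simp add: is_hda_def)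
  note x = \<open>x \<in> hcubes A (Suc (Suc n))\<close>
  show ?case
  proof (cases "n = 0")
    case True
    then have "i = Suc 0" "x \<in> hcubes A 2" "r \<in> {1, 2}"
      using Suc.prems by (auto simp: numeral_2_eq_2)
    moreover from this have "lab A (hface A 2 0 r x) = lab A (hface A 2 1 r x)"
      using Suc.prems unfolding is_hda_def by blast
    ultimately show ?thesis using True by (simp add: numeral_2_eq_2 initial_simps)
  next
    case False
    define s where "s = (if i = Suc n then n else Suc n)"
    have edge: "initial_edge (pcs A) (Suc n) i y
        = initial_edge (pcs A) n (min i n) (hface A (Suc n) 0 s y)" for y
      using Suc.prems False
      by (cases "i = Suc n") (auto simp: s_def initial_simps min_def)
    \<comment> \<open>\<open>t\<close> is direction \<open>s\<close> of the face renumbered as a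
      direction of \<open>x\<close>; \<open>r'\<close> is the index of \<open>r\<close> once
      \<open>t\<close> is gone.\<close>
    define t r' where "t = (if r \<le> s then Suc s else s)" and "r' = (if r \<le> s then r else r - 1)"
    have comm: "hface A (Suc n) 0 s (hface A (Suc (Suc n)) k r x)
        = hface A (Suc n) k r' (hface A (Suc (Suc n)) 0 t x)" if "k \<in> {0, 1}" for k
    proof (cases "r \<le> s")
      case True
      then show ?thesis
        using that P x Suc.prems face_face[of "pcs A" x "Suc n" k 0 r "Suc s"]
        by (auto simp: t_def r'_def s_def)
    next
      case r: False
      then show ?thesis
        using that P x Suc.prems False face_face[of "pcs A" x "Suc n" 0 k s r]
        by (auto simp: t_def r'_def s_def)
    qed
    have "lab A (initial_edge (pcs A) n (min i n) (hface A (Suc n) 1 r' (hface A (Suc (Suc n)) 0 t x)))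
        = lab A (initial_edge (pcs A) n (min i n) (hface A (Suc n) 0 r' (hface A (Suc (Suc n)) 0 t x)))"
      using Suc.prems P x False
      by (intro Suc.IH face_in_cubes) (auto simp: t_def r'_def s_def split: if_splits)
    then show ?thesis unfolding edge by (simp add: comm)
  qed
qed simp

text \<open>All directions except \<open>i\<close> and \<open>j\<close> are removed. In the
  remaining square, d^0_2 is the edge in direction 1 and d^0_1 the edge in direction 2, so HM2
  orders their labels.\<close>

lemma initial_edge_labels_increasing:
  assumes "is_hda A" "HM2 A T" "x \<in> hcubes A n" "1 \<le> i" "i < j" "j \<le> n"
  shows "(lab A (initial_edge (pcs A) n i x), lab A (initial_edge (pcs A) n j x)) \<in> ltimes T"
  using assms
proof (induction n arbitrary: x i j)
  case (Suc n)
  have P: "precubical_set (pcs A)" using Suc.prems by (simp add: is_hda_def)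
  show ?case
  proof (cases "n = 1")
    case True
    have "i = 1" "j = 2" using Suc.prems True by auto
    moreover have "(lab A (hface A 2 0 2 x), lab A (hface A 2 0 1 x)) \<in> ltimes T"
      using Suc.prems True unfolding HM2_def numeral_2_eq_2 by auto
    ultimately show ?thesis using True by (simp add: numeral_2_eq_2 initial_simps)
  next
    case False
    then have n: "n \<ge> 2" using Suc.prems by simp
    \<comment> \<open>Here \<open>x\<close> has at least three directions, so one can be removed
      while keeping \<open>i\<close> and \<open>j\<close>.\<close>
    have "\<exists>r. 1 \<le> r \<and> r \<le> 3 \<and> r \<noteq> i \<and> r \<noteq> j"
      by presburger
    then obtain r where r: "1 \<le> r" "r \<le> Suc n" "r \<noteq> i" "r \<noteq> j"
      using n by (metis Suc_le_mono le_trans numeral_2_eq_2 numeral_3_eq_3)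
    define y where "y = hface A (Suc n) 0 r x"
    \<comment> \<open>\<open>f\<close> renumbers the directions other than \<open>r\<close> and
      keeps their order, so \<open>f i < f j\<close>.\<close>
    define f where "f = (\<lambda>k. if k < r then k else k - 1)"
    have f: "initial_edge (pcs A) (Suc n) k x = initial_edge (pcs A) n (f k) y"
      if "1 \<le> k" "k \<le> Suc n" "k \<noteq> r" for k
      using initial_edge_face0[OF P, of x n r "f k"] Suc.prems r that
      by (auto simp: f_def y_def split: if_splits)
    have "(lab A (initial_edge (pcs A) n (f i) y), lab A (initial_edge (pcs A) n (f j) y))
        \<in> ltimes T"
      unfolding y_def
      using Suc.prems P r by (intro Suc.IH face_in_cubes) (auto simp: f_def)
    then show ?thesis using f Suc.prems r by (simp)
  qed
qed simp

text \<open>The last value is the one to which all other values are related, which fixes it within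
  the range; it is split off by induction.\<close>

lemma increasing_enumeration_unique:
  fixes f g :: "nat \<Rightarrow> 'a"
  assumes "asym R" "f ` {1..n} = g ` {1..n}"
    and "\<And>i j. 1 \<le> i \<Longrightarrow> i < j \<Longrightarrow> j \<le> n \<Longrightarrow> (f i, f j) \<in> R"
    and "\<And>i j. 1 \<le> i \<Longrightarrow> i < j \<Longrightarrow> j \<le> n \<Longrightarrow> (g i, g j) \<in> R"
    and "i \<in> {1..n}"
  shows "f i = g i"
  using assms
proof (induction n arbitrary: i)
  case (Suc n)
  have asym: "(b, a) \<notin> R" if "(a, b) \<in> R" for a b
    using \<open>asym R\<close> that by (rule asymD)
  have last: "f (Suc n) = g (Suc n)"
  proof (rule ccontr)
    assume neq: "f (Suc n) \<noteq> g (Suc n)"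
    have "f (Suc n) \<in> g ` {1..Suc n}" "g (Suc n) \<in> f ` {1..Suc n}"
      using Suc.prems(2) by auto
    then obtain j k where j: "f (Suc n) = g j" "1 \<le> j" "j \<le> Suc n"
      and k: "g (Suc n) = f k" "1 \<le> k" "k \<le> Suc n"
      by auto
    \<comment> \<open>If the last values differed, each would occur earlier in the other
      enumeration, so they would be related both ways.\<close>
    then have "j < Suc n" "k < Suc n" using neq le_neq_implies_less by metis+
    then have "(g j, g (Suc n)) \<in> R" "(f k, f (Suc n)) \<in> R"
      using Suc.prems(3)[of k "Suc n"] Suc.prems(4)[of j "Suc n"] j k by auto
    then show False using j k asym by metis
  qed
  \<comment> \<open>Asymmetry excludes loops, so the last value does not recur and can be deleted
    from both ranges.\<close>
  have "f (Suc n) \<notin> f ` {1..n}" "g (Suc n) \<notin> g ` {1..n}"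
    using Suc.prems(3,4)[of _ "Suc n"] asym
    by (metis atLeastAtMost_iff imageE le_imp_less_Suc order_refl)+
  then have "f ` {1..n} = g ` {1..n}"
    using Suc.prems(2) last
    by (metis atLeastAtMostSuc_conv image_insert insert_ident le_add2 Suc_eq_plus1)
  then have "f i = g i" if "i \<in> {1..n}" for i
    using that Suc.prems by (intro Suc.IH) auto
  then show ?case using last Suc.prems(5) by (cases "i = Suc n") auto
qed simp

section \<open>Reconstruction of a cube from its initial vertex and labels\<close>

lemma HM1_deterministic_edges:
  assumes "HM1 A T" "deterministic T" "x \<in> hcubes A 1" "y \<in> hcubes A 1"
    and "lab A x = lab A y" "hface A 1 0 1 x = hface A 1 0 1 y"
  shows "x = y"
proof -
  have "hcubes (skeleton1 A) 1 = hcubes (underlying T) 1"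
    using assms(1) unfolding HM1_def same_hda_def by blast
  then have "hcubes A 1 = hcubes (underlying T) 1"
    by (simp add: skeleton1_def)
  moreover have "lab A e = lab (underlying T) e"
    "hface A 1 0 1 e = hface (underlying T) 1 0 1 e" if "e \<in> hcubes A 1" for e
    using assms(1) that unfolding HM1_def same_hda_def skeleton1_def by auto
  ultimately show ?thesis
    using assms unfolding deterministic_def by metis
qed

text \<open>Agreement of initial vertices and labels passes to all faces, so HM3 closes degrees from
  2 on. A vertex is its own initial vertex and an edge its own initial edge.\<close>

lemma cube_eqI:
  assumes "is_hda A" "HM1 A T" "deterministic T" "HM3 A"
    and "x \<in> hcubes A n" "y \<in> hcubes A n"
    and "initial_vertex (pcs A) n x = initial_vertex (pcs A) n y"
    and "\<And>i. 1 \<le> i \<Longrightarrow> i \<le> n \<Longrightarrow>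
      lab A (initial_edge (pcs A) n i x) = lab A (initial_edge (pcs A) n i y)"
  shows "x = y"
  using assms
proof (induction n arbitrary: x y)
  case (Suc n)
  have P: "precubical_set (pcs A)" using Suc.prems by (simp add: is_hda_def)
  have edge: "initial_edge (pcs A) (Suc n) i x = initial_edge (pcs A) (Suc n) i y"
    if "1 \<le> i" "i \<le> Suc n" for i
    using \<open>HM1 A T\<close> \<open>deterministic T\<close>
  proof (rule HM1_deterministic_edges)
    show "hface A 1 0 1 (initial_edge (pcs A) (Suc n) i x)
        = hface A 1 0 1 (initial_edge (pcs A) (Suc n) i y)"
      using P Suc.prems(5-7) that by (simp only: initial_vertex_initial_edge)
  qed (use P Suc.prems(5,6,8) that in \<open>blast intro: initial_edge_in_cubes\<close>)+
  show ?case
  proof (cases "n = 0")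
    case True
    then show ?thesis using edge[of 1] by simp
  next
    case False
    have face0_lab: "lab A (initial_edge (pcs A) n i (hface A (Suc n) 0 r x))
        = lab A (initial_edge (pcs A) n i (hface A (Suc n) 0 r y))"
      if "1 \<le> r" "r \<le> Suc n" "1 \<le> i" "i \<le> n" for r i
      using that P Suc.prems(5,6) edge[of "if i < r then i else Suc i"]
      by (simp add: initial_edge_face0)
    have face0: "hface A (Suc n) 0 r x = hface A (Suc n) 0 r y" if r: "1 \<le> r" "r \<le> Suc n" for r
    proof (rule Suc.IH)
      show "initial_vertex (pcs A) n (hface A (Suc n) 0 r x)
          = initial_vertex (pcs A) n (hface A (Suc n) 0 r y)"
        using r P Suc.prems(5-7) by (simp only: initial_vertex_face0)
    qed (use r P Suc.prems(1-6) face0_lab in \<open>simp_all add: face_in_cubes\<close>)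
    \<comment> \<open>Equal \<open>r\<close>-th initial edges have equal ends, where the upper faces
      start; the labels there are those of the parallel edges in the lower faces.\<close>
    have face1: "hface A (Suc n) 1 r x = hface A (Suc n) 1 r y" if r: "1 \<le> r" "r \<le> Suc n" for r
    proof (rule Suc.IH)
      show "initial_vertex (pcs A) n (hface A (Suc n) 1 r x)
          = initial_vertex (pcs A) n (hface A (Suc n) 1 r y)"
        using r P Suc.prems(5,6) edge[OF r] by (simp only: initial_vertex_face1)
      show "lab A (initial_edge (pcs A) n i (hface A (Suc n) 1 r x))
          = lab A (initial_edge (pcs A) n i (hface A (Suc n) 1 r y))" if "1 \<le> i" "i \<le> n" for i
        using that r P Suc.prems(1,5,6) face0_lab[of r i]
        by (simp only: lab_initial_edge_face1)
    qed (use r P Suc.prems(1-6) in \<open>simp_all add: face_in_cubes\<close>)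
    have "\<forall>r\<in>{1..Suc n}. \<forall>k\<in>{0, 1}. hface A (Suc n) k r x = hface A (Suc n) k r y"
      using face0 face1 by simp
    then show ?thesis
      using Suc.prems(4,5,6) False unfolding HM3_def
      by (metis Suc_le_eq less_Suc_eq_0_disj not_less_eq numeral_2_eq_2)
  qed
qed simp

theorem theorem4p9:
  fixes A :: "('c, 'l) hda" and T :: "('c, 'l) ltimes_ts"
    and v :: 'c and n :: nat and \<alpha> :: "nat \<Rightarrow> 'l"
  assumes "is_hda A"
    and "ltimes_transition_system T"
    and "deterministic T"
    and "asym (ltimes T)"
    and "HM1 A T" and "HM2 A T" and "HM3 A"
    and "v \<in> hcubes A 0"
    and "n \<ge> 2"
    and "\<forall>i\<in>{1..n}. \<alpha> i \<in> alphabet A"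
  shows "\<exists>\<^sub>\<le>\<^sub>1 x. x \<in> hcubes A n \<and>
           faces (pcs A) 0 [1..<Suc n] n x = v \<and>
           {lab A (faces (pcs A) 0 ([1..<i] @ [Suc i..<Suc n]) n x) |i. i \<in> {1..n}} =
           {\<alpha> i |i. i \<in> {1..n}}"
  unfolding initial_vertex_def[symmetric] initial_edge_def[symmetric]
proof (rule Uniq_I, elim conjE)
  let ?l = "\<lambda>x i. lab A (initial_edge (pcs A) n i x)"
  fix x y
  assume x: "x \<in> hcubes A n" and y: "y \<in> hcubes A n"
    and vx: "initial_vertex (pcs A) n x = v"
    and vy: "initial_vertex (pcs A) n y = v"
    and lx: "{?l x i |i. i \<in> {1..n}} = {\<alpha> i |i. i \<in> {1..n}}"
    and ly: "{?l y i |i. i \<in> {1..n}} = {\<alpha> i |i. i \<in> {1..n}}"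
  have im: "?l x ` {1..n} = ?l y ` {1..n}"
    using lx ly by (simp only: image_def Setcompr_eq_image)
  \<comment> \<open>Both label sequences increase for \<open>ltimes T\<close> and have the same
    range, so they agree direction by direction.\<close>
  have labels: "?l x i = ?l y i" if "i \<in> {1..n}" for i
    using \<open>asym (ltimes T)\<close> im _ _ that
  proof (rule increasing_enumeration_unique)
    fix i j :: nat
    assume "1 \<le> i" "i < j" "j \<le> n"
    then show "(?l x i, ?l x j) \<in> ltimes T" "(?l y i, ?l y j) \<in> ltimes T"
      using initial_edge_labels_increasing[OF \<open>is_hda A\<close> \<open>HM2 A T\<close>] x y by blast+
  qed
  show "x = y"
    using \<open>is_hda A\<close> \<open>HM1 A T\<close> \<open>deterministic T\<close> \<open>HM3 A\<close> x y
  proof (rule cube_eqI)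
    show "initial_vertex (pcs A) n x = initial_vertex (pcs A) n y"
      using vx vy by (simp only:)
    show "?l x i = ?l y i" if "1 \<le> i" "i \<le> n" for i
      using labels that by (simp only: atLeastAtMost_iff)
  qed
qed

end
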